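(* Suppose that the $\mathbb{N}$-based Smullyan model $M_{\mathbb{N}}$ satisfies T-Tarski$^+$, i.e. there is no $H\in\mathrm{Pred}$ with $\mathrm{True}_{M_{\mathbb{N}}}^+=\Phi_{\mathbb{N}}(H)\cap\mathrm{Sent}^+$. Then the set $\mathsf{TA}$ of all $\mathcal{L}_A$-sentences true in $\mathbb{N}$ is not definable in $\mathbb{N}$ (i.e. there is no $v$-formula $\varphi(v)$ defining in $\mathbb{N}$ the set of Gödel numbers of elements of $\mathsf{TA}$).
   Context: Arithmetic. $\mathcal{L}_A$ is the language of first-order arithmetic, containing a function symbol for each primitive recursive function; $\mathbb{N}$ is also the standard $\mathcal{L}_A$-structure; $\overline{n}$ is the numeral of $n$. Fix a natural Gödel numbering; $\ulcorner\psi\urcorner$ is the Gödel number of $\psi$, and inside formulas also its numeral. Fix a variable $v$. A $v$-formula is an $\mathcal{L}_A$-formula with no free variables other than $v$ (possibly none); $\varphi_i(v)$ is the $v$-formula with Gödel number $i$; $\Gamma$ is the set of Gödel numbers of $v$-formulas; $\psi(t)$ is the result of substituting the term $t$ for $v$ in $\psi(v)$. $d$ is the primitive recursive function (and its function symbol) with $d(i)=\ulcorner\varphi_i(\overline{i})\urcorner$ if $i\in\Gamma$ and $d(i)=0$ otherwise. $\equiv$ is syntactic identity and $\neg^k$ is a string of $k$ negations. Frame. Let $\mathsf{n},\mathsf{r},a_i$ $(i\in\Gamma)$ be pairwise distinct symbols, $\Sigma=\{a_i: i\in\Gamma\}\cup\{\mathsf{n},\mathsf{r}\}$, $\Sigma^\ast$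 the set of finite strings over $\Sigma$ (including the empty string $\epsilon$), $\mathrm{Pred}=\{Xa_i: X\in\{\mathsf{n},\mathsf{r}\}^\ast, i\in\Gamma\}$, $\mathrm{Sent}=\{HX: H\in\mathrm{Pred}, X\in\Sigma^\ast\}$ (the decomposition $HX$ is unique), $\mathrm{Sent}^+=\mathrm{Sent}\setminus\mathrm{Pred}$. Map $I$ from $\mathrm{Pred}$ to $v$-formulas: $I(\mathsf{n}^k a_i)\equiv\neg^k\varphi_i(v)$; $I(\mathsf{n}^k\mathsf{r}\mathsf{n}^l a_i)\equiv\neg^{k+l}\varphi_i(d(v))$; $I(\mathsf{n}^k\mathsf{r}\mathsf{n}^l\mathsf{r}Y a_i)\equiv\neg^{k+l}\bot$ ($k,l\ge0$, $Y\in\{\mathsf{n},\mathsf{r}\}^\ast$). Map $J$ from $\mathrm{Sent}$ to $\mathcal{L}_A$-sentences, defined inductively for $H\in\mathrm{Pred}$, $X\in\Sigma^\ast$: if $X\in\mathrm{Pred}$, $J(HX)\equiv I(H)(\ulcorner I(X)(v)\urcorner)$; if $X\notin\mathrm{Sent}$, $J(a_iX)\equiv I(a_i)(0)$, $J(\mathsf{r}HX)\equiv\bot$, $J(\mathsf{n}HX)\equiv\neg J(HX)$; if $X\in\mathrm{Sent}^+$, $J(a_iX)\equiv I(a_i)(\ulcorner J(X)\urcorner)$, $J(\mathsf{r}HX)\equiv\bot$, $J(\mathsf{n}HX)\equiv\neg J(HX)$. Model. $M_{\mathbb{N}}=(\Sigma,\mathrm{Pred},\Phi_{\mathbb{N}})$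 with $\Phi_{\mathbb{N}}(H)=\{X\in\Sigma^\ast: \mathbb{N}\models J(HX)\}$. $\mathrm{True}_{M_{\mathbb{N}}}=\{HX: H\in\mathrm{Pred}, X\in\Phi_{\mathbb{N}}(H)\}$ and $\mathrm{True}_{M_{\mathbb{N}}}^+=\mathrm{True}_{M_{\mathbb{N}}}\cap\mathrm{Sent}^+$. *)

theory Defs
  imports Main "HOL-Library.Nat_Bijection" "HOL-Library.More_List"
begin

section \<open>Primitive recursive functions\<close>

text \<open>
  Descriptions of primitive recursive functions. A description p is read on argument lists of
  any length: for each k it describes a k-ary primitive recursive function, where missing
  arguments count as 0 and superfluous ones are ignored. Restricted to the list length for which
  a description is intended, the clauses are the textbook ones.
\<close>

datatype pdesc = Zero | Succ | Proj nat | Comp pdesc "pdesc list" | Rec pdesc pdesc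

abbreviation arg :: "nat \<Rightarrow> nat list \<Rightarrow> nat" where
  "arg i xs \<equiv> nth_default 0 xs i"

fun pdesc_val :: "pdesc \<Rightarrow> nat list \<Rightarrow> nat" where
  "pdesc_val Zero xs = 0"
| "pdesc_val Succ xs = Suc (arg 0 xs)"
| "pdesc_val (Proj i) xs = arg i xs"
| "pdesc_val (Comp f gs) xs = pdesc_val f (map (\<lambda>g. pdesc_val g xs) gs)"
| "pdesc_val (Rec f g) xs =
     rec_nat (pdesc_val f (tl xs)) (\<lambda>k r. pdesc_val g (k # r # tl xs)) (arg 0 xs)"

section \<open>The language of arithmetic and the standard structure\<close>

text \<open>
  The function symbols are the pairs (p, k) of a description p and an arity k; the symbol (p, k)
  denotes the k-ary function described by p. In a term \<open>Fn p ts\<close> the arity is not written, as it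
  is the length of ts; so every term of the datatype is well-formed.
\<close>

datatype tm = Var nat | Fn pdesc "tm list"

text \<open>The other connectives and the existential quantifier are classically definable.\<close>

datatype fm = Bot | Eq tm tm | Neg fm | Imp fm fm | Forall nat fm

fun tm_val :: "(nat \<Rightarrow> nat) \<Rightarrow> tm \<Rightarrow> nat" where
  "tm_val e (Var x) = e x"
| "tm_val e (Fn p ts) = pdesc_val p (map (tm_val e) ts)"

fun sat :: "(nat \<Rightarrow> nat) \<Rightarrow> fm \<Rightarrow> bool" where
  "sat e Bot \<longleftrightarrow> False"
| "sat e (Eq s t) \<longleftrightarrow> tm_val e s = tm_val e t"
| "sat e (Neg \<phi>) \<longleftrightarrow> \<not> sat e \<phi>"
| "sat e (Imp \<phi> \<psi>) \<longleftrightarrow> (sat e \<phi> \<longrightarrow> sat e \<psi>)"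
| "sat e (Forall x \<phi>) \<longleftrightarrow> (\<forall>n. sat (e(x := n)) \<phi>)"

definition true_in_N :: "fm \<Rightarrow> bool" where
  "true_in_N \<phi> \<longleftrightarrow> (\<forall>e. sat e \<phi>)"

fun fv_tm :: "tm \<Rightarrow> nat set" where
  "fv_tm (Var x) = {x}"
| "fv_tm (Fn p ts) = (\<Union>t\<in>set ts. fv_tm t)"

fun fv :: "fm \<Rightarrow> nat set" where
  "fv Bot = {}"
| "fv (Eq s t) = fv_tm s \<union> fv_tm t"
| "fv (Neg \<phi>) = fv \<phi>"
| "fv (Imp \<phi> \<psi>) = fv \<phi> \<union> fv \<psi>"
| "fv (Forall x \<phi>) = fv \<phi> - {x}"

definition sentence :: "fm \<Rightarrow> bool" where
  "sentence \<phi> \<longleftrightarrow> fv \<phi> = {}"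

text \<open>
  Substitution of a term for the free occurrences of a variable, without renaming of bound
  variables. The terms substituted for a variable x below contain no variable other than x, so
  no variable is ever captured.
\<close>

fun subst_tm :: "nat \<Rightarrow> tm \<Rightarrow> tm \<Rightarrow> tm" where
  "subst_tm x s (Var y) = (if y = x then s else Var y)"
| "subst_tm x s (Fn p ts) = Fn p (map (subst_tm x s) ts)"

fun subst :: "nat \<Rightarrow> tm \<Rightarrow> fm \<Rightarrow> fm" where
  "subst x s Bot = Bot"
| "subst x s (Eq t u) = Eq (subst_tm x s t) (subst_tm x s u)"
| "subst x s (Neg \<phi>) = Neg (subst x s \<phi>)"
| "subst x s (Imp \<phi> \<psi>) = Imp (subst x s \<phi>) (subst x s \<psi>)"
| "subst x s (Forall y \<phi>) = (if y = x then Forall y \<phi> else Forall y (subst x s \<phi>))"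

fun num :: "nat \<Rightarrow> tm" where
  "num 0 = Fn Zero []"
| "num (Suc n) = Fn Succ [num n]"

text \<open>The distinguished variable v is the first one.\<close>

definition v :: nat where
  "v = 0"

definition v_formula :: "fm \<Rightarrow> bool" where
  "v_formula \<phi> \<longleftrightarrow> fv \<phi> \<subseteq> {v}"

definition inst :: "fm \<Rightarrow> tm \<Rightarrow> fm" where
  "inst \<phi> t = subst v t \<phi>"

section \<open>Goedel numbering\<close>

fun pdesc_code :: "pdesc \<Rightarrow> nat" where
  "pdesc_code Zero = 0"
| "pdesc_code Succ = 1"
| "pdesc_code (Proj i) = 3 * i + 2"
| "pdesc_code (Comp f gs) = 3 * prod_encode (pdesc_code f, list_encode (map pdesc_code gs)) + 3"
| "pdesc_code (Rec f g) = 3 * prod_encode (pdesc_code f, pdesc_code g) + 4"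

fun tm_code :: "tm \<Rightarrow> nat" where
  "tm_code (Var x) = 2 * x"
| "tm_code (Fn p ts) = 2 * prod_encode (pdesc_code p, list_encode (map tm_code ts)) + 1"

fun fm_code :: "fm \<Rightarrow> nat" where
  "fm_code Bot = 0"
| "fm_code (Eq s t) = 4 * prod_encode (tm_code s, tm_code t) + 1"
| "fm_code (Neg \<phi>) = 4 * fm_code \<phi> + 2"
| "fm_code (Imp \<phi> \<psi>) = 4 * prod_encode (fm_code \<phi>, fm_code \<psi>) + 3"
| "fm_code (Forall x \<phi>) = 4 * prod_encode (x, fm_code \<phi>) + 4"

text \<open>The number 0 is not the Goedel number of any formula.\<close>

definition gn :: "fm \<Rightarrow> nat" where
  "gn \<phi> = Suc (fm_code \<phi>)"

definition \<Gamma> :: "nat set" where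
  "\<Gamma> = gn ` {\<phi>. v_formula \<phi>}"

definition fml :: "nat \<Rightarrow> fm" where
  "fml i = (THE \<phi>. gn \<phi> = i)"

definition d :: "nat \<Rightarrow> nat" where
  "d i = (if i \<in> \<Gamma> then gn (inst (fml i) (num i)) else 0)"

subsection \<open>Injectivity\<close>

lemma pdesc_code_inj: "pdesc_code p = pdesc_code q \<Longrightarrow> p = q"
proof (induction p arbitrary: q)
  case Zero
  then show ?case by (cases q) auto
next
  case Succ
  then show ?case by (cases q) auto
next
  case (Proj i)
  then show ?case by (cases q; simp; presburger)
next
  case (Comp f gs)
  from Comp.prems show ?case
  proof (cases q)
    case (Comp f' gs')
    with Comp.prems have *: "pdesc_code f = pdesc_code f'" "map pdesc_code gs = map pdesc_code gs'"
      by (auto simp: list_encode_eq)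
    have "gs = gs'"
      using *(2) Comp.IH(2) by (intro list.inj_map_strong[OF _ *(2)]) auto
    with *(1) Comp.IH(1) show ?thesis by (simp add: Comp)
  qed (simp; presburger)+
next
  case (Rec f g)
  from Rec.prems show ?case
  proof (cases q)
    case (Rec f' g')
    with Rec.prems Rec.IH show ?thesis by auto
  qed (simp; presburger)+
qed

lemma tm_code_inj: "tm_code s = tm_code t \<Longrightarrow> s = t"
proof (induction s arbitrary: t)
  case (Var x)
  then show ?case by (cases t; simp; presburger)
next
  case (Fn p ts)
  show ?case
  proof (cases t)
    case (Var x)
    with Fn.prems show ?thesis by simp presburger
  next
    case (Fn p' ts')
    with Fn.prems have *: "pdesc_code p = pdesc_code p'" "map tm_code ts = map tm_code ts'"
      by (auto simp: list_encode_eq)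
    have "ts = ts'"
      using *(2) Fn.IH by (intro list.inj_map_strong[OF _ *(2)]) auto
    with *(1) pdesc_code_inj show ?thesis by (simp add: Fn)
  qed
qed

lemma fm_code_inj: "fm_code \<phi> = fm_code \<psi> \<Longrightarrow> \<phi> = \<psi>"
proof (induction \<phi> arbitrary: \<psi>)
  case Bot
  then show ?case by (cases \<psi>) auto
next
  case (Eq s t)
  then show ?case by (cases \<psi>; simp add: tm_code_inj; presburger)
next
  case (Neg \<phi>)
  then show ?case by (cases \<psi>; simp; presburger)
next
  case (Imp \<phi>1 \<phi>2)
  then show ?case by (cases \<psi>; simp; presburger)
next
  case (Forall x \<phi>)
  then show ?case by (cases \<psi>; simp; presburger)
qed

lemma gn_inj: "gn \<phi> = gn \<psi> \<Longrightarrow> \<phi> = \<psi>"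
  by (simp add: gn_def fm_code_inj)

lemma fml_gn [simp]: "fml (gn \<phi>) = \<phi>"
  unfolding fml_def by (rule the_equality) (auto dest: gn_inj)

subsection \<open>Surjectivity\<close>

text \<open>Every number codes a description and a term, every positive number codes a formula.\<close>

lemma prod_decode_le:
  "fst (prod_decode n) \<le> n" "snd (prod_decode n) \<le> n"
  by (metis le_prod_encode_1 prod.collapse prod_decode_inverse,
      metis le_prod_encode_2 prod.collapse prod_decode_inverse)

lemma list_decode_le: "x \<in> set (list_decode n) \<Longrightarrow> x < n"
proof (induction n rule: list_decode.induct)
  case (2 n)
  then show ?case
    using prod_decode_le[of n] by (cases "prod_decode n") fastforce
qed simp

lemma list_code_surj:
  assumes "\<And>x. x < n \<Longrightarrow> \<exists>y. f y = x"
  shows "\<exists>ys. list_encode (map f ys) = n"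
proof -
  have "list_decode n \<in> lists (range f)"
    using list_decode_le assms by (metis in_listsI rangeI)
  then obtain ys where "list_decode n = map f ys"
    by (auto simp: lists_image)
  then show ?thesis
    by (metis list_decode_inverse)
qed

lemma pdesc_code_surj: "\<exists>p. pdesc_code p = n"
proof (induction n rule: less_induct)
  case (less n)
  consider "n = 0" | "n = 1" | i where "n = 3 * i + 2" | k where "n = 3 * k + 3"
    | k where "n = 3 * k + 4"
    by atomize_elim presburger
  then show ?case
  proof cases
    case (4 k)
    then have "fst (prod_decode k) < n"
      using prod_decode_le[of k] by linarith
    then obtain f where "pdesc_code f = fst (prod_decode k)"
      using less by blast
    moreover obtain gs where "list_encode (map pdesc_code gs) = snd (prod_decode k)"
      using list_code_surj[of "snd (prod_decode k)" pdesc_code] less 4 prod_decode_le(2)[of k]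
      by fastforce
    ultimately have "pdesc_code (Comp f gs) = n"
      using 4 by simp
    then show ?thesis ..
  next
    case (5 k)
    have "fst (prod_decode k) < n" "snd (prod_decode k) < n"
      using 5 prod_decode_le[of k] by linarith+
    then obtain f g where "pdesc_code f = fst (prod_decode k)" "pdesc_code g = snd (prod_decode k)"
      using less by metis
    then have "pdesc_code (Rec f g) = n"
      using 5 by simp
    then show ?thesis ..
  qed (metis pdesc_code.simps(1), metis pdesc_code.simps(2), metis pdesc_code.simps(3))
qed

lemma tm_code_surj: "\<exists>t. tm_code t = n"
proof (induction n rule: less_induct)
  case (less n)
  consider x where "n = 2 * x" | k where "n = 2 * k + 1"
    by atomize_elim presburger
  then show ?case
  proof cases
    case (2 k)
    obtain p where "pdesc_code p = fst (prod_decode k)"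
      using pdesc_code_surj by blast
    moreover obtain ts where "list_encode (map tm_code ts) = snd (prod_decode k)"
      using list_code_surj[of "snd (prod_decode k)" tm_code] less 2 prod_decode_le(2)[of k]
      by fastforce
    ultimately have "tm_code (Fn p ts) = n"
      using 2 by simp
    then show ?thesis ..
  qed (metis tm_code.simps(1))
qed

lemma fm_code_surj: "\<exists>\<phi>. fm_code \<phi> = n"
proof (induction n rule: less_induct)
  case (less n)
  consider "n = 0" | k where "n = 4 * k + 1" | k where "n = 4 * k + 2"
    | k where "n = 4 * k + 3" | k where "n = 4 * k + 4"
    by atomize_elim presburger
  then show ?case
  proof cases
    case (2 k)
    obtain s t where "tm_code s = fst (prod_decode k)" "tm_code t = snd (prod_decode k)"
      using tm_code_surj by metis
    then have "fm_code (Eq s t) = n"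
      using 2 by simp
    then show ?thesis ..
  next
    case (3 k)
    then have "k < n"
      by simp
    then obtain \<phi> where "fm_code \<phi> = k"
      using less by blast
    then have "fm_code (Neg \<phi>) = n"
      using 3 by simp
    then show ?thesis ..
  next
    case (4 k)
    have "fst (prod_decode k) < n" "snd (prod_decode k) < n"
      using 4 prod_decode_le[of k] by linarith+
    then obtain \<phi> \<psi> where "fm_code \<phi> = fst (prod_decode k)" "fm_code \<psi> = snd (prod_decode k)"
      using less by metis
    then have "fm_code (Imp \<phi> \<psi>) = n"
      using 4 by simp
    then show ?thesis ..
  next
    case (5 k)
    have "snd (prod_decode k) < n"
      using 5 prod_decode_le[of k] by linarith
    then obtain \<phi> where "fm_code \<phi> = snd (prod_decode k)"
      using less by metis
    then have "fm_code (Forall (fst (prod_decode k)) \<phi>) = n"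
      using 5 by simp
    then show ?thesis ..
  qed (metis fm_code.simps(1))
qed

section \<open>The diagonal function d is primitive recursive\<close>

subsection \<open>Closure properties of primitive recursive functions\<close>

definition pr :: "(nat list \<Rightarrow> nat) \<Rightarrow> bool" where
  "pr f \<longleftrightarrow> (\<exists>p. \<forall>xs. pdesc_val p xs = f xs)"

named_theorems pr_intros

lemma pr_arg [pr_intros]: "pr (\<lambda>xs. arg i xs)"
  unfolding pr_def by (rule exI[of _ "Proj i"]) simp

lemma pr_comp:
  assumes "pr f" "\<forall>g\<in>set gs. pr g"
  shows "pr (\<lambda>xs. f (map (\<lambda>g. g xs) gs))"
proof -
  obtain p where p: "\<And>xs. pdesc_val p xs = f xs"
    using assms(1) by (auto simp: pr_def)
  obtain q where q: "\<And>g xs. g \<in> set gs \<Longrightarrow> pdesc_val (q g) xs = g xs"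
    using assms(2) unfolding pr_def by metis
  have "map (\<lambda>g. pdesc_val g xs) (map q gs) = map (\<lambda>g. g xs) gs" for xs
    using q by simp
  then have "pdesc_val (Comp p (map q gs)) xs = f (map (\<lambda>g. g xs) gs)" for xs
    by (metis p pdesc_val.simps(4))
  then show ?thesis
    unfolding pr_def by blast
qed

lemma pr_comp1:
  "pr (\<lambda>ys. f (arg 0 ys)) \<Longrightarrow> pr a \<Longrightarrow> pr (\<lambda>xs. f (a xs))"
  using pr_comp[of "\<lambda>ys. f (arg 0 ys)" "[a]"] by simp

lemma pr_comp2:
  "pr (\<lambda>ys. f (arg 0 ys) (arg 1 ys)) \<Longrightarrow> pr a \<Longrightarrow> pr b \<Longrightarrow> pr (\<lambda>xs. f (a xs) (b xs))"
  using pr_comp[of "\<lambda>ys. f (arg 0 ys) (arg 1 ys)" "[a, b]"] by simp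

lemma pr_comp3:
  "pr (\<lambda>ys. f (arg 0 ys) (arg 1 ys) (arg 2 ys)) \<Longrightarrow> pr a \<Longrightarrow> pr b \<Longrightarrow> pr c
    \<Longrightarrow> pr (\<lambda>xs. f (a xs) (b xs) (c xs))"
  using pr_comp[of "\<lambda>ys. f (arg 0 ys) (arg 1 ys) (arg 2 ys)" "[a, b, c]"]
  by (simp add: numeral_2_eq_2)

lemma pr_comp4:
  "pr (\<lambda>ys. f (arg 0 ys) (arg 1 ys) (arg 2 ys) (arg 3 ys)) \<Longrightarrow> pr a \<Longrightarrow> pr b \<Longrightarrow> pr c \<Longrightarrow> pr e
    \<Longrightarrow> pr (\<lambda>xs. f (a xs) (b xs) (c xs) (e xs))"
  using pr_comp[of "\<lambda>ys. f (arg 0 ys) (arg 1 ys) (arg 2 ys) (arg 3 ys)" "[a, b, c, e]"]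
  by (simp add: numeral_2_eq_2 numeral_3_eq_3)

lemma pr_Suc [pr_intros]: "pr a \<Longrightarrow> pr (\<lambda>xs. Suc (a xs))"
proof (rule pr_comp1[where f = Suc])
  show "pr (\<lambda>ys. Suc (arg 0 ys))"
    unfolding pr_def by (rule exI[of _ Succ]) simp
qed

lemma pr_const [pr_intros]: "pr (\<lambda>xs. c)"
proof (induction c)
  case 0
  show ?case
    unfolding pr_def by (rule exI[of _ Zero]) simp
qed (rule pr_Suc)

lemma pr_rec:
  assumes b: "pr (\<lambda>ys. b (arg 0 ys) (arg 1 ys))"
    and g: "pr (\<lambda>ys. g (arg 0 ys) (arg 1 ys) (arg 2 ys) (arg 3 ys))"
    and n: "pr n" and x: "pr x" and s: "pr s"
  shows "pr (\<lambda>xs. rec_nat (b (x xs) (s xs)) (\<lambda>k r. g k r (x xs) (s xs)) (n xs))"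
proof (rule pr_comp3[OF _ n x s])
  obtain p where p: "\<And>ys. pdesc_val p ys = b (arg 0 ys) (arg 1 ys)"
    using b by (auto simp: pr_def)
  obtain q where q: "\<And>ys. pdesc_val q ys = g (arg 0 ys) (arg 1 ys) (arg 2 ys) (arg 3 ys)"
    using g by (auto simp: pr_def)
  have tl: "arg 0 (tl ys) = arg 1 ys" "arg (Suc 0) (tl ys) = arg 2 ys" for ys
    by (cases ys; simp add: numeral_2_eq_2)+
  have "pdesc_val (Rec p q) ys
      = rec_nat (b (arg 1 ys) (arg 2 ys)) (\<lambda>k r. g k r (arg 1 ys) (arg 2 ys)) (arg 0 ys)" for ys
    by (simp add: p q tl numeral_2_eq_2 numeral_3_eq_3)
  then show "pr (\<lambda>ys. rec_nat (b (arg 1 ys) (arg 2 ys))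
      (\<lambda>k r. g k r (arg 1 ys) (arg 2 ys)) (arg 0 ys))"
    unfolding pr_def by blast
qed

lemma pr_rec0:
  assumes "pr (\<lambda>ys. g (arg 0 ys) (arg 1 ys))" "pr n"
  shows "pr (\<lambda>xs. rec_nat c g (n xs))"
  using pr_rec[of "\<lambda>_ _. c" "\<lambda>k r _ _. g k r" n "\<lambda>_. 0" "\<lambda>_. 0"] assms pr_const by simp

lemma pr_rec1:
  assumes "pr (\<lambda>ys. b (arg 0 ys))" "pr (\<lambda>ys. g (arg 0 ys) (arg 1 ys) (arg 2 ys))" "pr n" "pr x"
  shows "pr (\<lambda>xs. rec_nat (b (x xs)) (\<lambda>k r. g k r (x xs)) (n xs))"
  using pr_rec[of "\<lambda>x _. b x" "\<lambda>k r x _. g k r x" n x "\<lambda>_. 0"] assms pr_const by simp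

lemma pr_pred [pr_intros]: "pr a \<Longrightarrow> pr (\<lambda>xs. a xs - Suc 0)"
proof -
  have "rec_nat 0 (\<lambda>k r. k) n = n - Suc 0" for n
    by (cases n) auto
  then show "pr a \<Longrightarrow> pr (\<lambda>xs. a xs - Suc 0)"
    using pr_rec0[of "\<lambda>k r. k" a 0] by (simp add: pr_intros)
qed

lemma pr_add [pr_intros]: "pr a \<Longrightarrow> pr b \<Longrightarrow> pr (\<lambda>xs. a xs + b xs)"
proof -
  have "rec_nat m (\<lambda>k r. Suc r) n = n + m" for m n
    by (induction n) auto
  then show "pr a \<Longrightarrow> pr b \<Longrightarrow> pr (\<lambda>xs. a xs + b xs)"
    using pr_rec1[of "\<lambda>m. m" "\<lambda>k r _. Suc r" a b] by (simp add: pr_intros)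
qed

lemma pr_diff [pr_intros]: "pr a \<Longrightarrow> pr b \<Longrightarrow> pr (\<lambda>xs. a xs - b xs)"
proof -
  have "rec_nat m (\<lambda>k r. r - Suc 0) n = m - n" for m n
    by (induction n) auto
  then show "pr a \<Longrightarrow> pr b \<Longrightarrow> pr (\<lambda>xs. a xs - b xs)"
    using pr_rec1[of "\<lambda>m. m" "\<lambda>k r _. r - Suc 0" b a] by (simp add: pr_intros)
qed

lemma pr_mult [pr_intros]: "pr a \<Longrightarrow> pr b \<Longrightarrow> pr (\<lambda>xs. a xs * b xs)"
proof -
  have "rec_nat 0 (\<lambda>k r. r + m) n = n * m" for m n
    by (induction n) auto
  then show "pr a \<Longrightarrow> pr b \<Longrightarrow> pr (\<lambda>xs. a xs * b xs)"
    using pr_rec1[of "\<lambda>m. 0" "\<lambda>k r m. r + m" a b] by (simp add: pr_intros)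
qed

lemma pr_if [pr_intros]:
  assumes "pr a" "pr b" "pr c" "pr e"
  shows "pr (\<lambda>xs. if a xs = b xs then c xs else e xs)"
proof -
  have "pr (\<lambda>xs. rec_nat (c xs) (\<lambda>k r. e xs) ((a xs - b xs) + (b xs - a xs)))"
    by (rule pr_rec[where b = "\<lambda>c e. c" and g = "\<lambda>k r c e. e"]) (intro pr_intros assms)+
  moreover have "rec_nat y (\<lambda>k r. z) ((m - n) + (n - m)) = (if m = n then y else z)"
    for y z m n :: nat
    by (cases "(m - n) + (n - m)") auto
  ultimately show ?thesis
    by simp
qed

lemma pr_mod [pr_intros]: "k > 0 \<Longrightarrow> pr a \<Longrightarrow> pr (\<lambda>xs. a xs mod k)"
proof -
  assume k: "k > 0"
  then have "rec_nat 0 (\<lambda>_ r. if Suc r = k then 0 else Suc r) n = n mod k" for n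
    by (induction n) (auto simp: mod_Suc)
  then show "pr a \<Longrightarrow> pr (\<lambda>xs. a xs mod k)"
    using pr_rec0[of "\<lambda>_ r. if Suc r = k then 0 else Suc r" a 0] by (simp add: pr_intros)
qed

lemma pr_div [pr_intros]: "k > 0 \<Longrightarrow> pr a \<Longrightarrow> pr (\<lambda>xs. a xs div k)"
proof -
  assume k: "k > 0"
  then have "rec_nat 0 (\<lambda>n r. if Suc n mod k = 0 then Suc r else r) n = n div k" for n
    by (induction n) (auto simp: div_Suc)
  then show "pr a \<Longrightarrow> pr (\<lambda>xs. a xs div k)"
    using pr_rec0[of "\<lambda>n r. if Suc n mod k = 0 then Suc r else r" a 0] k by (simp add: pr_intros)
qed

abbreviation enc :: "nat \<Rightarrow> nat \<Rightarrow> nat" where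
  "enc a b \<equiv> prod_encode (a, b)"

abbreviation dec1 :: "nat \<Rightarrow> nat" where
  "dec1 n \<equiv> fst (prod_decode n)"

abbreviation dec2 :: "nat \<Rightarrow> nat" where
  "dec2 n \<equiv> snd (prod_decode n)"

lemma pr_triangle [pr_intros]: "pr a \<Longrightarrow> pr (\<lambda>xs. triangle (a xs))"
  unfolding triangle_def by (intro pr_intros) auto

lemma pr_enc [pr_intros]: "pr a \<Longrightarrow> pr b \<Longrightarrow> pr (\<lambda>xs. enc (a xs) (b xs))"
  unfolding prod_encode_def prod.case by (intro pr_intros)

text \<open>The largest k with \<open>triangle k \<le> n\<close>.\<close>

definition troot :: "nat \<Rightarrow> nat" where
  "troot = rec_nat 0 (\<lambda>n r. if Suc n = triangle (Suc r) then Suc r else r)"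

lemma pr_troot [pr_intros]: "pr a \<Longrightarrow> pr (\<lambda>xs. troot (a xs))"
  unfolding troot_def by (rule pr_rec0) (intro pr_intros)

lemma troot_bounds: "triangle (troot n) \<le> n \<and> n < triangle (Suc (troot n))"
  by (induction n) (auto simp: troot_def)

lemma dec_troot: "dec1 n = n - triangle (troot n)" "dec2 n = troot n - dec1 n"
proof -
  let ?a = "n - triangle (troot n)"
  have "enc ?a (troot n - ?a) = n"
    using troot_bounds[of n] by (simp add: prod_encode_def)
  then have "prod_decode n = (?a, troot n - ?a)"
    by (metis prod_encode_inverse)
  then show "dec1 n = n - triangle (troot n)" "dec2 n = troot n - dec1 n"
    by simp_all
qed

lemma pr_dec1 [pr_intros]: "pr a \<Longrightarrow> pr (\<lambda>xs. dec1 (a xs))"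
  unfolding dec_troot by (intro pr_intros)

lemma pr_dec2 [pr_intros]: "pr a \<Longrightarrow> pr (\<lambda>xs. dec2 (a xs))"
  unfolding dec_troot by (intro pr_intros)

subsection \<open>Course-of-values recursion\<close>

text \<open>
  \<open>cov F x s n\<close> is F applied to n, the code of the list of the values at n - 1, ..., 0, and the
  parameters x and s; inside F, \<open>lookup n r i\<close> retrieves the value at i.
\<close>

definition hist :: "(nat \<Rightarrow> nat \<Rightarrow> nat \<Rightarrow> nat \<Rightarrow> nat) \<Rightarrow> nat \<Rightarrow> nat \<Rightarrow> nat \<Rightarrow> nat" where
  "hist F x s n = rec_nat 0 (\<lambda>k r. Suc (enc (F k r x s) r)) n"

definition cov :: "(nat \<Rightarrow> nat \<Rightarrow> nat \<Rightarrow> nat \<Rightarrow> nat) \<Rightarrow> nat \<Rightarrow> nat \<Rightarrow> nat \<Rightarrow> nat" where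
  "cov F x s n = F n (hist F x s n) x s"

definition lookup :: "nat \<Rightarrow> nat \<Rightarrow> nat \<Rightarrow> nat" where
  "lookup n r i = dec1 (rec_nat r (\<lambda>_ q. dec2 (q - Suc 0)) (n - Suc i) - Suc 0)"

lemma lookup_hist:
  assumes "i < n"
  shows "lookup n (hist F x s n) i = cov F x s i"
proof -
  have "rec_nat (hist F x s n) (\<lambda>_ q. dec2 (q - Suc 0)) j = hist F x s (n - j)" if "j \<le> n" for j
    using that
  proof (induction j)
    case (Suc j)
    then have "n - j = Suc (n - Suc j)"
      by simp
    with Suc show ?case
      by (simp add: hist_def)
  qed simp
  moreover have "n - (n - Suc i) = Suc i" "n - Suc i \<le> n"
    using assms by auto
  ultimately show ?thesis
    by (simp add: lookup_def cov_def) (simp add: hist_def)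
qed

lemma pr_lookup [pr_intros]:
  assumes "pr n" "pr r" "pr i"
  shows "pr (\<lambda>xs. lookup (n xs) (r xs) (i xs))"
  unfolding lookup_def
  by (intro pr_dec1 pr_pred pr_rec1[where b = "\<lambda>r. r" and g = "\<lambda>_ q _. dec2 (q - Suc 0)"])
    (intro pr_intros assms)+

lemma pr_cov:
  assumes F: "pr (\<lambda>ys. F (arg 0 ys) (arg 1 ys) (arg 2 ys) (arg 3 ys))"
    and "pr x" "pr s" "pr n"
  shows "pr (\<lambda>xs. cov F (x xs) (s xs) (n xs))"
proof -
  have "pr (\<lambda>xs. hist F (x xs) (s xs) (n xs))"
    unfolding hist_def
    by (rule pr_rec[where b = "\<lambda>_ _. 0" and g = "\<lambda>k r x s. Suc (enc (F k r x s) r)"])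
      (intro pr_intros assms)+
  with assms show ?thesis
    unfolding cov_def by (intro pr_comp4[OF F])
qed

subsection \<open>Substitution on codes\<close>

text \<open>Terms and (coded) lists of terms are treated simultaneously.\<close>

definition tm_step :: "nat \<Rightarrow> nat \<Rightarrow> nat \<Rightarrow> nat \<Rightarrow> nat" where
  "tm_step k r x s = enc
     (if k mod 2 = 0 then if k div 2 = x then s else k
      else Suc (2 * enc (dec1 (k div 2)) (dec2 (lookup k r (dec2 (k div 2))))))
     (if k = 0 then 0
      else Suc (enc (dec1 (lookup k r (dec1 (k - Suc 0)))) (dec2 (lookup k r (dec2 (k - Suc 0))))))"

definition sub_tm :: "nat \<Rightarrow> nat \<Rightarrow> nat \<Rightarrow> nat" where
  "sub_tm x s n = dec1 (cov tm_step x s n)"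

definition sub_tms :: "nat \<Rightarrow> nat \<Rightarrow> nat \<Rightarrow> nat" where
  "sub_tms x s n = dec2 (cov tm_step x s n)"

lemma pr_sub_tm [pr_intros]:
  "pr x \<Longrightarrow> pr s \<Longrightarrow> pr n \<Longrightarrow> pr (\<lambda>xs. sub_tm (x xs) (s xs) (n xs))"
  unfolding sub_tm_def by (intro pr_dec1 pr_cov) (unfold tm_step_def, intro pr_intros, auto)

lemma sub_tm_simps:
  "sub_tm x s (2 * y) = (if y = x then s else 2 * y)"
  "sub_tm x s (Suc (2 * enc p ts)) = Suc (2 * enc p (sub_tms x s ts))"
  "sub_tms x s 0 = 0"
  "sub_tms x s (Suc (enc t ts)) = Suc (enc (sub_tm x s t) (sub_tms x s ts))"
proof -
  have *: "ts < Suc (2 * enc p ts)" "t < Suc (enc t ts)" "ts < Suc (enc t ts)"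
    using le_prod_encode_1[of t ts] le_prod_encode_2[of ts t] le_prod_encode_2[of ts p] by auto
  show "sub_tm x s (2 * y) = (if y = x then s else 2 * y)"
    by (simp add: sub_tm_def cov_def tm_step_def)
  show "sub_tm x s (Suc (2 * enc p ts)) = Suc (2 * enc p (sub_tms x s ts))"
    by (subst sub_tm_def, subst cov_def) (simp add: tm_step_def lookup_hist * sub_tms_def)
  show "sub_tms x s 0 = 0"
    by (simp add: sub_tms_def cov_def tm_step_def)
  show "sub_tms x s (Suc (enc t ts)) = Suc (enc (sub_tm x s t) (sub_tms x s ts))"
    by (subst sub_tms_def, subst cov_def)
      (simp add: tm_step_def lookup_hist * sub_tms_def sub_tm_def)
qed

lemma sub_tm_code: "sub_tm x (tm_code s) (tm_code t) = tm_code (subst_tm x s t)"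
proof (induction t)
  case (Fn p ts)
  then have "sub_tms x (tm_code s) (list_encode (map tm_code ts))
      = list_encode (map tm_code (map (subst_tm x s) ts))"
    by (induction ts) (auto simp: sub_tm_simps)
  then show ?case
    by (simp add: sub_tm_simps)
qed (simp add: sub_tm_simps)

definition fm_step :: "nat \<Rightarrow> nat \<Rightarrow> nat \<Rightarrow> nat \<Rightarrow> nat" where
  "fm_step k r x s =
     (if k = 0 then 0
      else if (k - Suc 0) mod 4 = 0 then
        Suc (4 * enc (sub_tm x s (dec1 ((k - Suc 0) div 4))) (sub_tm x s (dec2 ((k - Suc 0) div 4))))
      else if (k - Suc 0) mod 4 = 1 then
        4 * lookup k r ((k - Suc 0) div 4) + 2
      else if (k - Suc 0) mod 4 = 2 then
        4 * enc (lookup k r (dec1 ((k - Suc 0) div 4))) (lookup k r (dec2 ((k - Suc 0) div 4))) + 3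
      else if dec1 ((k - Suc 0) div 4) = x then k
      else 4 * enc (dec1 ((k - Suc 0) div 4)) (lookup k r (dec2 ((k - Suc 0) div 4))) + 4)"

definition sub_fm :: "nat \<Rightarrow> nat \<Rightarrow> nat \<Rightarrow> nat" where
  "sub_fm = cov fm_step"

lemma pr_sub_fm [pr_intros]:
  "pr x \<Longrightarrow> pr s \<Longrightarrow> pr n \<Longrightarrow> pr (\<lambda>xs. sub_fm (x xs) (s xs) (n xs))"
  unfolding sub_fm_def by (intro pr_cov) (unfold fm_step_def, intro pr_intros, auto)

lemma fm_code_mod_div:
  fixes e :: nat
  shows "(4 * e + 2 - Suc 0) mod 4 = 1" "(4 * e + 2 - Suc 0) div 4 = e"
    "(4 * e + 3 - Suc 0) mod 4 = 2" "(4 * e + 3 - Suc 0) div 4 = e"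
    "(4 * e + 4 - Suc 0) mod 4 = 3" "(4 * e + 4 - Suc 0) div 4 = e"
proof -
  have "4 * e + 2 - Suc 0 = 1 + 4 * e" "4 * e + 3 - Suc 0 = 2 + 4 * e"
    "4 * e + 4 - Suc 0 = 3 + 4 * e"
    by simp_all
  then show "(4 * e + 2 - Suc 0) mod 4 = 1" "(4 * e + 2 - Suc 0) div 4 = e"
    "(4 * e + 3 - Suc 0) mod 4 = 2" "(4 * e + 3 - Suc 0) div 4 = e"
    "(4 * e + 4 - Suc 0) mod 4 = 3" "(4 * e + 4 - Suc 0) div 4 = e"
    by (simp_all only: mod_mult_self2 div_mult_self2) simp_all
qed

lemma fm_step_simps:
  "fm_step 0 r x s = 0"
  "fm_step (Suc (4 * e)) r x s = Suc (4 * enc (sub_tm x s (dec1 e)) (sub_tm x s (dec2 e)))"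
  "fm_step (4 * e + 2) r x s = 4 * lookup (4 * e + 2) r e + 2"
  "fm_step (4 * e + 3) r x s
    = 4 * enc (lookup (4 * e + 3) r (dec1 e)) (lookup (4 * e + 3) r (dec2 e)) + 3"
  "fm_step (4 * e + 4) r x s
    = (if dec1 e = x then 4 * e + 4
       else 4 * enc (dec1 e) (lookup (4 * e + 4) r (dec2 e)) + 4)"
  unfolding fm_step_def fm_code_mod_div by simp_all

lemma sub_fm_unfold: "sub_fm x s k = fm_step k (hist fm_step x s k) x s"
  by (simp add: sub_fm_def cov_def)

lemma lookup_sub_fm: "i < k \<Longrightarrow> lookup k (hist fm_step x s k) i = sub_fm x s i"
  by (simp add: sub_fm_def lookup_hist)

lemma sub_fm_simps:
  "sub_fm x s 0 = 0"
  "sub_fm x s (Suc (4 * enc t u)) = Suc (4 * enc (sub_tm x s t) (sub_tm x s u))"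
  "sub_fm x s (4 * f + 2) = 4 * sub_fm x s f + 2"
  "sub_fm x s (4 * enc f g + 3) = 4 * enc (sub_fm x s f) (sub_fm x s g) + 3"
  "sub_fm x s (4 * enc y f + 4) = 4 * enc y (if y = x then f else sub_fm x s f) + 4"
proof -
  have *: "f < 4 * f + 2" "f < 4 * enc f g + 3" "g < 4 * enc f g + 3" "f < 4 * enc y f + 4"
    using le_prod_encode_1[of f g] le_prod_encode_2[of g f] le_prod_encode_2[of f y] by linarith+
  note unf = sub_fm_unfold[of x s "4 * f + 2"] sub_fm_unfold[of x s "4 * enc f g + 3"]
    sub_fm_unfold[of x s "4 * enc y f + 4"]
  show "sub_fm x s 0 = 0"
    by (simp add: sub_fm_unfold fm_step_simps)
  show "sub_fm x s (Suc (4 * enc t u)) = Suc (4 * enc (sub_tm x s t) (sub_tm x s u))"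
    by (simp add: sub_fm_unfold fm_step_simps)
  show "sub_fm x s (4 * f + 2) = 4 * sub_fm x s f + 2"
    unfolding unf fm_step_simps lookup_sub_fm[OF *(1)] ..
  show "sub_fm x s (4 * enc f g + 3) = 4 * enc (sub_fm x s f) (sub_fm x s g) + 3"
    unfolding unf fm_step_simps prod_encode_inverse fst_conv snd_conv
      lookup_sub_fm[OF *(2)] lookup_sub_fm[OF *(3)] ..
  show "sub_fm x s (4 * enc y f + 4) = 4 * enc y (if y = x then f else sub_fm x s f) + 4"
    unfolding unf fm_step_simps prod_encode_inverse fst_conv snd_conv lookup_sub_fm[OF *(4)]
    by auto
qed

lemma sub_fm_code: "sub_fm x (tm_code s) (fm_code \<phi>) = fm_code (subst x s \<phi>)"
proof (induction \<phi>)
  case (Eq t u)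
  show ?case
    using sub_fm_simps(2) by (simp add: sub_tm_code)
next
  case (Neg \<phi>)
  then show ?case
    by (simp only: fm_code.simps subst.simps sub_fm_simps)
next
  case (Imp \<phi> \<psi>)
  then show ?case
    by (simp only: fm_code.simps subst.simps sub_fm_simps)
next
  case (Forall y \<phi>)
  then show ?case
    by (simp only: fm_code.simps subst.simps sub_fm_simps split: if_split) simp
qed (simp add: sub_fm_simps)

subsection \<open>The diagonal function\<close>

lemma subst_tm_Zero_iff: "subst_tm x (Fn Zero []) t = t \<longleftrightarrow> x \<notin> fv_tm t"
proof (induction t)
  case (Fn p ts)
  then show ?case
    by (auto simp: map_idI dest: map_eq_conv[THEN iffD1, of _ ts id, simplified])
qed auto

lemma subst_Zero_iff: "subst x (Fn Zero []) \<phi> = \<phi> \<longleftrightarrow> x \<notin> fv \<phi>"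
  by (induction \<phi>) (auto simp: subst_tm_Zero_iff)

lemma list_encode_less: "x \<in> set xs \<Longrightarrow> x < list_encode xs"
  by (metis list_decode_le list_encode_inverse)

lemma fv_tm_le: "x \<in> fv_tm t \<Longrightarrow> x \<le> tm_code t"
proof (induction t)
  case (Fn p ts)
  then obtain t where t: "t \<in> set ts" "x \<le> tm_code t"
    by auto
  then have "tm_code t < list_encode (map tm_code ts)"
    by (intro list_encode_less) auto
  with t show ?case
    using le_prod_encode_2[of "list_encode (map tm_code ts)" "pdesc_code p"] by simp
qed auto

lemma fv_less: "x \<in> fv \<phi> \<Longrightarrow> x < fm_code \<phi>"
proof (induction \<phi>)
  case (Eq s t)
  then show ?case
    using fv_tm_le[of x s] fv_tm_le[of x t] le_prod_encode_1[of "tm_code s" "tm_code t"]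
      le_prod_encode_2[of "tm_code t" "tm_code s"] by auto
next
  case (Imp \<phi> \<psi>)
  then show ?case
    using le_prod_encode_1[of "fm_code \<phi>" "fm_code \<psi>"]
      le_prod_encode_2[of "fm_code \<psi>" "fm_code \<phi>"] by auto
next
  case (Forall y \<phi>)
  then show ?case
    using le_prod_encode_2[of "fm_code \<phi>" y] by auto
qed auto

text \<open>The number of free variables other than v below a bound.\<close>

definition other_fv :: "nat \<Rightarrow> nat \<Rightarrow> nat" where
  "other_fv n c = rec_nat 0
     (\<lambda>x r. if x = v then r else if sub_fm x (tm_code (Fn Zero [])) c = c then r else Suc r) n"

lemma pr_other_fv [pr_intros]: "pr n \<Longrightarrow> pr c \<Longrightarrow> pr (\<lambda>xs. other_fv (n xs) (c xs))"
  unfolding other_fv_def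
  by (rule pr_rec1[where b = "\<lambda>_. 0" and g = "\<lambda>x r c. if x = v then r
    else if sub_fm x (tm_code (Fn Zero [])) c = c then r else Suc r"]) (intro pr_intros; assumption)+

lemma other_fv_eq_0: "other_fv (fm_code \<phi>) (fm_code \<phi>) = 0 \<longleftrightarrow> v_formula \<phi>"
proof -
  have "other_fv n (fm_code \<phi>) = 0 \<longleftrightarrow> (\<forall>x<n. x \<in> fv \<phi> \<longrightarrow> x = v)" for n
  proof (induction n)
    case (Suc n)
    have "sub_fm n (tm_code (Fn Zero [])) (fm_code \<phi>) = fm_code \<phi> \<longleftrightarrow> n \<notin> fv \<phi>"
      unfolding sub_fm_code using fm_code_inj subst_Zero_iff by metis
    with Suc show ?case
      by (simp add: other_fv_def less_Suc_eq) blast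
  qed (simp add: other_fv_def)
  then show ?thesis
    using fv_less by (auto simp: v_formula_def)
qed

definition num_code :: "nat \<Rightarrow> nat" where
  "num_code = rec_nat (tm_code (Fn Zero [])) (\<lambda>_ r. Suc (2 * enc (pdesc_code Succ) (Suc (enc r 0))))"

lemma pr_num_code [pr_intros]: "pr n \<Longrightarrow> pr (\<lambda>xs. num_code (n xs))"
  unfolding num_code_def by (rule pr_rec0) (intro pr_intros; assumption)+

lemma num_code: "num_code n = tm_code (num n)"
  by (induction n) (auto simp: num_code_def)

lemma d_eq:
  "d i = (if i = 0 then 0
    else if other_fv (i - Suc 0) (i - Suc 0) = 0 then Suc (sub_fm v (num_code i) (i - Suc 0)) else 0)"
proof (cases i)
  case 0
  then show ?thesis
    by (auto simp: d_def \<Gamma>_def gn_def)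
next
  case (Suc c)
  obtain \<phi> where \<phi>: "fm_code \<phi> = c"
    using fm_code_surj by blast
  then have i: "i = gn \<phi>"
    by (simp add: gn_def Suc)
  then have "i \<in> \<Gamma> \<longleftrightarrow> v_formula \<phi>"
    by (auto simp: \<Gamma>_def dest: gn_inj)
  moreover have "fml i = \<phi>"
    by (simp add: i)
  ultimately show ?thesis
    using other_fv_eq_0[of \<phi>] sub_fm_code[of v "num i" \<phi>]
    by (simp add: d_def inst_def gn_def num_code \<phi> Suc)
qed

theorem d_primitive_recursive: "\<exists>p. \<forall>i. pdesc_val p [i] = d i"
proof -
  have "pr (\<lambda>xs. d (arg 0 xs))"
    unfolding d_eq by (intro pr_intros)
  then obtain p where "\<And>xs. pdesc_val p xs = d (arg 0 xs)"
    by (auto simp: pr_def)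
  then have "pdesc_val p [i] = d i" for i
    by simp
  then show ?thesis
    by blast
qed


text \<open>A function symbol for d, to be used with one argument.\<close>

definition d_sym :: pdesc where
  "d_sym = (SOME p. \<forall>i. pdesc_val p [i] = d i)"

lemma d_sym [simp]: "pdesc_val d_sym [i] = d i"
  using someI_ex[OF d_primitive_recursive] by (simp add: d_sym_def)

section \<open>Smullyan models\<close>

text \<open>Alphabet, predicates, and the map sending a predicate to the set of strings it holds of.\<close>

type_synonym 'a smullyan_model = "'a set \<times> 'a list set \<times> ('a list \<Rightarrow> 'a list set)"

definition sentences :: "'a set \<Rightarrow> 'a list set \<Rightarrow> 'a list set" where
  "sentences \<Sigma> P = {H @ X | H X. H \<in> P \<and> X \<in> lists \<Sigma>}"

fun True_set :: "'a smullyan_model \<Rightarrow> 'a list set" where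
  "True_set (\<Sigma>, P, \<Phi>) = {H @ X | H X. H \<in> P \<and> X \<in> \<Phi> H}"

fun True_plus :: "'a smullyan_model \<Rightarrow> 'a list set" where
  "True_plus (\<Sigma>, P, \<Phi>) = True_set (\<Sigma>, P, \<Phi>) \<inter> (sentences \<Sigma> P - P)"

fun T_Tarski_plus :: "'a smullyan_model \<Rightarrow> bool" where
  "T_Tarski_plus (\<Sigma>, P, \<Phi>) \<longleftrightarrow>
     \<not> (\<exists>H\<in>P. True_plus (\<Sigma>, P, \<Phi>) = \<Phi> H \<inter> (sentences \<Sigma> P - P))"

section \<open>The model based on the standard structure\<close>

datatype symb = SymN | SymR | SymA nat

definition Sigma_N :: "symb set" where
  "Sigma_N = SymA ` \<Gamma> \<union> {SymN, SymR}"

definition Pred :: "symb list set" where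
  "Pred = {X @ [SymA i] | X i. X \<in> lists {SymN, SymR} \<and> i \<in> \<Gamma>}"

definition Sent :: "symb list set" where
  "Sent = sentences Sigma_N Pred"

text \<open>
  The map I; \<open>predI_r\<close> translates what follows the first r. Only the values on \<open>Pred\<close> matter.
\<close>

fun predI_r :: "symb list \<Rightarrow> fm" where
  "predI_r [SymA i] = inst (fml i) (Fn d_sym [Var v])"
| "predI_r (SymN # X) = Neg (predI_r X)"
| "predI_r _ = Bot"

fun predI :: "symb list \<Rightarrow> fm" where
  "predI [SymA i] = fml i"
| "predI (SymN # X) = Neg (predI X)"
| "predI (SymR # X) = predI_r X"
| "predI _ = Bot"

lemma predI_n: "predI (replicate k SymN @ [SymA i]) = (Neg ^^ k) (fml i)"
  by (induction k) auto

lemma predI_nrn: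
  "predI (replicate k SymN @ [SymR] @ replicate l SymN @ [SymA i])
     = (Neg ^^ (k + l)) (inst (fml i) (Fn d_sym [Var v]))"
proof -
  have "predI_r (replicate l SymN @ [SymA i]) = (Neg ^^ l) (inst (fml i) (Fn d_sym [Var v]))"
    by (induction l) auto
  then show ?thesis
    by (induction k) auto
qed

lemma predI_nrnr:
  "predI (replicate k SymN @ [SymR] @ replicate l SymN @ [SymR] @ Y @ [SymA i])
     = (Neg ^^ (k + l)) Bot"
proof -
  have "predI_r (replicate l SymN @ [SymR] @ Y @ [SymA i]) = (Neg ^^ l) Bot"
    by (induction l) auto
  then show ?thesis
    by (induction k) auto
qed

text \<open>For the unique decomposition of a sentence as HX with H in \<open>Pred\<close>, this is X.\<close>

fun sent_arg :: "symb list \<Rightarrow> symb list" where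
  "sent_arg [] = []"
| "sent_arg (SymA i # X) = X"
| "sent_arg (SymN # W) = sent_arg W"
| "sent_arg (SymR # W) = sent_arg W"

fun sent_pred :: "symb list \<Rightarrow> symb list" where
  "sent_pred [] = []"
| "sent_pred (SymA i # X) = [SymA i]"
| "sent_pred (SymN # W) = SymN # sent_pred W"
| "sent_pred (SymR # W) = SymR # sent_pred W"

text \<open>
  The map J. Only the values on \<open>Sent\<close> matter; the defining clauses in terms of the
  decomposition HX are derived below.
\<close>

fun sentJ :: "symb list \<Rightarrow> fm" where
  "sentJ [] = Bot"
| "sentJ (SymA i # X) =
     (if X \<in> Pred then inst (predI [SymA i]) (num (gn (predI X)))
      else if X \<in> Sent then inst (predI [SymA i]) (num (gn (sentJ X)))
      else inst (predI [SymA i]) (num 0))"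
| "sentJ (SymR # W) =
     (if sent_arg W \<in> Pred
      then inst (predI (SymR # sent_pred W)) (num (gn (predI (sent_arg W))))
      else Bot)"
| "sentJ (SymN # W) =
     (if sent_arg W \<in> Pred
      then inst (predI (SymN # sent_pred W)) (num (gn (predI (sent_arg W))))
      else Neg (sentJ W))"

lemma sent_decomp:
  assumes "H \<in> Pred"
  shows "sent_pred (H @ X) = H" "sent_arg (H @ X) = X"
proof -
  obtain Y i where H: "H = Y @ [SymA i]" and Y: "Y \<in> lists {SymN, SymR}"
    using assms by (auto simp: Pred_def)
  from Y have "sent_pred (Y @ SymA i # X) = Y @ [SymA i] \<and> sent_arg (Y @ SymA i # X) = X"
    by (induction Y) auto
  then show "sent_pred (H @ X) = H" "sent_arg (H @ X) = X"
    by (simp_all add: H)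
qed

lemma sentJ_Pred:
  assumes "H \<in> Pred" "X \<in> Pred"
  shows "sentJ (H @ X) = inst (predI H) (num (gn (predI X)))"
proof (cases H)
  case Nil
  with assms show ?thesis
    by (simp add: Pred_def)
next
  case (Cons s W)
  show ?thesis
  proof (cases s)
    case (SymA i)
    with Cons assms(1) have "W = []"
      by (auto simp: Pred_def Cons_eq_append_conv)
    with Cons SymA assms show ?thesis
      by simp
  qed (use Cons sent_decomp[OF assms(1), of X] assms in auto)
qed

lemma sentJ_a_nonsent: "X \<notin> Pred \<Longrightarrow> X \<notin> Sent \<Longrightarrow> sentJ (SymA i # X) = inst (predI [SymA i]) (num 0)"
  by simp

lemma sentJ_a_sent: "X \<in> Sent - Pred \<Longrightarrow> sentJ (SymA i # X) = inst (predI [SymA i]) (num (gn (sentJ X)))"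
  by simp

lemma sentJ_r: "H \<in> Pred \<Longrightarrow> X \<notin> Pred \<Longrightarrow> sentJ (SymR # H @ X) = Bot"
  by (simp add: sent_decomp)

lemma sentJ_n: "H \<in> Pred \<Longrightarrow> X \<notin> Pred \<Longrightarrow> sentJ (SymN # H @ X) = Neg (sentJ (H @ X))"
  by (simp add: sent_decomp)

definition Phi_N :: "symb list \<Rightarrow> symb list set" where
  "Phi_N H = {X \<in> lists Sigma_N. true_in_N (sentJ (H @ X))}"

definition M_N :: "symb smullyan_model" where
  "M_N = (Sigma_N, Pred, Phi_N)"

section \<open>Definability\<close>

definition TA :: "fm set" where
  "TA = {\<phi>. sentence \<phi> \<and> true_in_N \<phi>}"

definition definable_in_N :: "nat set \<Rightarrow> bool" where
  "definable_in_N A \<longleftrightarrow>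
     (\<exists>\<phi>. v_formula \<phi> \<and> (\<forall>n. n \<in> A \<longleftrightarrow> true_in_N (inst \<phi> (num n))))"

end

theory Submission
  imports Defs
begin

lemma fv_subst_tm: "fv_tm (subst_tm x s t) \<subseteq> (fv_tm t - {x}) \<union> fv_tm s"
  by (induction t) auto

text \<open>Only an inclusion: \<open>x\<close> may not occur free, and since \<open>subst\<close>
  does not rename, a quantifier may capture variables of \<open>s\<close>, which can only remove
  free variables.\<close>

lemma fv_subst: "fv (subst x s \<phi>) \<subseteq> (fv \<phi> - {x}) \<union> fv_tm s"
proof (induction \<phi>)
  case (Eq t u)
  then show ?case
    using fv_subst_tm[of x s t] fv_subst_tm[of x s u] by auto
qed auto

lemma fv_num [simp]: "fv_tm (num n) = {}"
  by (induction n) auto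

lemma sentence_inst_num: "v_formula \<phi> \<Longrightarrow> sentence (inst \<phi> (num n))"
  using fv_subst[of v "num n" \<phi>] by (auto simp: sentence_def v_formula_def inst_def)

text \<open>Meant for the term \<open>Fn d_sym [Var v]\<close> that \<open>predI_r\<close>
  substitutes, in which \<open>v\<close> reappears.\<close>

lemma v_formula_inst: "v_formula \<phi> \<Longrightarrow> fv_tm t \<subseteq> {v} \<Longrightarrow> v_formula (inst \<phi> t)"
  using fv_subst[of v t \<phi>] by (auto simp: v_formula_def inst_def)

lemma v_formula_Bot_Neg [simp]: "v_formula Bot" "v_formula (Neg \<phi>) \<longleftrightarrow> v_formula \<phi>"
  by (simp_all add: v_formula_def)

lemma v_formula_fml: "i \<in> \<Gamma> \<Longrightarrow> v_formula (fml i)"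
  by (auto simp: \<Gamma>_def)

lemma SymA_in_Sigma_N [simp]: "SymA i \<in> Sigma_N \<longleftrightarrow> i \<in> \<Gamma>"
  by (auto simp: Sigma_N_def)

text \<open>The alphabet restricts indices to \<Gamma>; elsewhere \<open>fml i\<close> may have
  other free variables.\<close>

lemma v_formula_predI_r: "W \<in> lists Sigma_N \<Longrightarrow> v_formula (predI_r W)"
  by (induction W rule: predI_r.induct) (auto simp: v_formula_fml intro: v_formula_inst)

lemma v_formula_predI: "W \<in> lists Sigma_N \<Longrightarrow> v_formula (predI W)"
  by (induction W rule: predI.induct) (auto simp: v_formula_fml v_formula_predI_r)

lemma sent_pred_lists: "W \<in> lists A \<Longrightarrow> sent_pred W \<in> lists A"
  by (induction W rule: sent_pred.induct) auto

lemma Pred_subset_lists: "Pred \<subseteq> lists Sigma_N"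
  by (auto simp: Pred_def Sigma_N_def)

lemma Sent_subset_lists: "Sent \<subseteq> lists Sigma_N"
  unfolding Sent_def sentences_def using Pred_subset_lists by fastforce

text \<open>
  Closedness holds on all strings over the alphabet, not only on \<open>Sent\<close>, because the junk values
  of \<open>predI\<close> and \<open>sentJ\<close> are negations of \<open>Bot\<close>; so plain induction on the string suffices.
\<close>

lemma sentence_sentJ: "W \<in> lists Sigma_N \<Longrightarrow> sentence (sentJ W)"
proof (induction W rule: sentJ.induct)
  case 1
  then show ?case
    by (simp add: sentence_def)
next
  case (2 i X)
  then show ?case
    by (simp add: sentence_inst_num v_formula_fml del: num.simps)
next
  case (3 W)
  then have "v_formula (predI (SymR # sent_pred W))"
    using sent_pred_lists[of W Sigma_N] by (intro v_formula_predI) auto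
  then show ?case
    by (auto simp: sentence_inst_num sentence_def[of Bot] simp del: predI.simps)
next
  case (4 W)
  then have "v_formula (predI (SymN # sent_pred W))"
    using sent_pred_lists[of W Sigma_N] by (intro v_formula_predI) auto
  with 4 show ?case
    by (auto simp: sentence_inst_num sentence_def[of "Neg _"] sentence_def[of "sentJ _"]
        simp del: predI.simps)
qed

text \<open>\<open>Phi_N\<close> evaluates \<open>sentJ\<close> on the whole string
  \<open>H @ X\<close>, so the choice of decomposition drops out.\<close>

lemma True_set_M_N: "True_set M_N = {X \<in> Sent. true_in_N (sentJ X)}"
  by (auto simp: M_N_def Phi_N_def Sent_def sentences_def)

theorem theorem5p11:
  assumes "T_Tarski_plus M_N"
  shows "\<not> definable_in_N (gn ` TA)"
proof
  assume "definable_in_N (gn ` TA)"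
  then obtain \<phi> where \<phi>: "v_formula \<phi>"
    and def: "\<And>n. n \<in> gn ` TA \<longleftrightarrow> true_in_N (inst \<phi> (num n))"
    unfolding definable_in_N_def by blast
  let ?H = "[SymA (gn \<phi>)]"
  have H: "?H \<in> Pred"
    using \<phi> by (auto simp: Pred_def \<Gamma>_def)
  have "X \<in> True_set M_N \<longleftrightarrow> X \<in> Phi_N ?H" if X: "X \<in> Sent - Pred" for X
  proof -
    have lists: "X \<in> lists Sigma_N"
      using X Sent_subset_lists by blast
    \<comment> \<open>\<open>TA\<close> contains only closed formulas, so truth of
      \<open>sentJ X\<close> must be paired with its closedness.\<close>
    have "X \<in> True_set M_N \<longleftrightarrow> sentJ X \<in> TA"
      using X sentence_sentJ[OF lists] by (simp add: True_set_M_N TA_def)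
    also have "\<dots> \<longleftrightarrow> gn (sentJ X) \<in> gn ` TA"
      by (auto dest: gn_inj)
    \<comment> \<open>As \<open>X\<close> is a sentence outside \<open>Pred\<close>,
      \<open>sentJ (?H @ X)\<close> is \<phi> applied to the numeral of \<open>gn (sentJ X)\<close>;
      for \<open>X\<close> in \<open>Pred\<close> the numeral would code \<open>predI X\<close>
      instead.\<close>
    also have "\<dots> \<longleftrightarrow> X \<in> Phi_N ?H"
      using X lists by (simp add: def Phi_N_def)
    finally show ?thesis .
  qed
  then have "True_plus M_N = Phi_N ?H \<inter> (sentences Sigma_N Pred - Pred)"
    by (auto simp: M_N_def Sent_def simp del: True_set.simps)
  with assms H show False
    by (auto simp: M_N_def simp del: True_plus.simps)
qed

end
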